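(* Let $\delta>0$, $q\in(0,1/2)$, and let $D=D(n)$ be positive integers with $D(n)/n\to0$ as $n\to\infty$. Put $\Gamma=\frac{\ln D}{\ln n}$ and $\gamma=\frac{\Gamma+\delta}{1+\delta}$. Then there is $n_0$ such that for every $n\ge n_0$, every integer $d$ with $1\le d\le D$, every input vector $\mathbf{x}\in\{0,1\}^n$ with exactly $d$ ones, and every integer $$T\ \ge\ \frac{16(1+\sqrt{\gamma})^2(1+\delta)\ln 2}{(1-e^{-2})(1-2q)^2}\,D\log_2 n,$$ the No-CoMa algorithm with $T$ tests satisfies $$\Pr[\hat{\mathbf{x}}\ne\mathbf{x}]\le n^{-\delta},$$ where the probability is over the random group-testing matrix and the measurement noise.
   Context: Group testing: there are $n$ items, of which an unknown subset of $d$ items is defective, encoded by $\mathbf{x}\in\{0,1\}^n$ ($x_j=1$ iff item $j$ is defective). Only an upper bound $D\ge d$ is known to the algorithm. A $T\times n$ binary group-testing matrix $M=(m_{i,j})$ specifies non-adaptive tests: item $j$ is in test $i$ iff $m_{i,j}=1$. The noiseless outcome $y_i\in\{0,1\}$ of test $i$ is $1$ iff test $i$ contains at least one defective item. Measurements are noisy: the observed outcome $\hat y_i$ differs from $y_i$ with probability $q$, independently across tests and independently of $M$. No-CoMa (Noisy Column Matching) algorithm. Encoding: the entries $m_{i,j}$ are i.i.d., equal to $1$ with probability $p$ and $0$ otherwise, where $p=1/D$ if $D\ge 2$, and $p=1/2$ if $D=1$. Decoding: for each item $j$ let $\mathcal{T}_j=\{i: m_{i,j}=1\}$ and $\mathcal{S}_j=\{i: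 m_{i,j}=1,\ \hat y_i=1\}$. Set $\hat x_j=1$ if $|\mathcal{S}_j|\ge|\mathcal{T}_j|\,(1-q(1+\tau))$ and $\hat x_j=0$ otherwise, where the threshold parameter is $\tau=\frac{1-2q}{4q(1+\gamma^{-1/2})}$ with $\gamma$ as in the claim. *)

theory Defs
  imports "HOL-Probability.Probability"
begin

text \<open>
  Binary entries are Booleans, items are \<open>0, \<dots>, n - 1\<close> and tests are \<open>0, \<dots>, T - 1\<close>.
  A group-testing matrix is a function of the pair (test, item); vectors and matrices are
  only ever inspected at indices in range.
\<close>

type_synonym gt_matrix = "nat \<times> nat \<Rightarrow> bool"

definition noiseless_outcome :: "nat \<Rightarrow> gt_matrix \<Rightarrow> (nat \<Rightarrow> bool) \<Rightarrow> nat \<Rightarrow> bool" where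
  "noiseless_outcome n M x i \<longleftrightarrow> (\<exists>j<n. M (i, j) \<and> x j)"

text \<open>The noise bit \<open>z i\<close> says whether the outcome of test \<open>i\<close> is flipped.\<close>

definition observed_outcome ::
  "nat \<Rightarrow> gt_matrix \<Rightarrow> (nat \<Rightarrow> bool) \<Rightarrow> (nat \<Rightarrow> bool) \<Rightarrow> nat \<Rightarrow> bool" where
  "observed_outcome n M z x i \<longleftrightarrow> noiseless_outcome n M x i \<noteq> z i"

definition tests_of :: "nat \<Rightarrow> gt_matrix \<Rightarrow> nat \<Rightarrow> nat set" where
  "tests_of T M j = {i. i < T \<and> M (i, j)}"

definition positive_tests_of :: "nat \<Rightarrow> gt_matrix \<Rightarrow> (nat \<Rightarrow> bool) \<Rightarrow> nat \<Rightarrow> nat set" where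
  "positive_tests_of T M y j = {i. i < T \<and> M (i, j) \<and> y i}"

definition nocoma_decode ::
  "nat \<Rightarrow> real \<Rightarrow> real \<Rightarrow> gt_matrix \<Rightarrow> (nat \<Rightarrow> bool) \<Rightarrow> nat \<Rightarrow> bool" where
  "nocoma_decode T q \<tau> M y j \<longleftrightarrow>
     real (card (positive_tests_of T M y j)) \<ge> real (card (tests_of T M j)) * (1 - q * (1 + \<tau>))"

definition nocoma_p :: "nat \<Rightarrow> real" where
  "nocoma_p D = (if D \<ge> 2 then 1 / real D else 1 / 2)"

definition nocoma_gamma :: "real \<Rightarrow> nat \<Rightarrow> nat \<Rightarrow> real" where
  "nocoma_gamma \<delta> n D = (ln (real D) / ln (real n) + \<delta>) / (1 + \<delta>)"

definition nocoma_tau :: "real \<Rightarrow> real \<Rightarrow> real" where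
  "nocoma_tau q \<gamma> = (1 - 2 * q) / (4 * q * (1 + \<gamma> powr (- 1 / 2)))"

text \<open>
  Joint law of the random matrix and the noise bits. The default value \<^term>\<open>False\<close> of
  \<^const>\<open>Pi_pmf\<close> only concerns indices out of range.
\<close>

definition nocoma_pmf :: "nat \<Rightarrow> nat \<Rightarrow> nat \<Rightarrow> real \<Rightarrow> (gt_matrix \<times> (nat \<Rightarrow> bool)) pmf" where
  "nocoma_pmf n T D q =
     pair_pmf (Pi_pmf ({..<T} \<times> {..<n}) False (\<lambda>_. bernoulli_pmf (nocoma_p D)))
              (Pi_pmf {..<T} False (\<lambda>_. bernoulli_pmf q))"

definition nocoma_error_prob ::
  "nat \<Rightarrow> nat \<Rightarrow> nat \<Rightarrow> real \<Rightarrow> real \<Rightarrow> (nat \<Rightarrow> bool) \<Rightarrow> real" where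
  "nocoma_error_prob n T D q \<tau> x =
     measure_pmf.prob (nocoma_pmf n T D q)
       {(M, z). \<exists>j<n. nocoma_decode T q \<tau> M (observed_outcome n M z x) j \<noteq> x j}"

end

theory Submission
  imports Defs
begin

text \<open>
  Write \<open>c = 1 - q (1 + \<tau>)\<close>. Item \<open>j\<close> is misclassified only if \<open>\<Sum>\<^sub>i m\<^sub>i\<^sub>j (y\<^sub>i - c)\<close>, with \<open>y\<^sub>i\<close> the
  observed outcome, has the wrong sign. The rows are independent, and given \<open>m\<^sub>i\<^sub>j = 1\<close> the
  outcome is Bernoulli with mean \<open>\<mu> = 1 - q\<close> (defective) or \<open>\<mu> = 1 - q - (1 - 2q)(1 - p)\<^sup>d\<close>
  (not defective). By Hoeffding's lemma a row contributes at most \<open>1 - p + p exp (- 2 (\<mu> - c)\<^sup>2)\<close>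
  to the Chernoff bound, so the error probability of one item is at most
  \<open>exp (- p T (1 - exp (- 2u)))\<close> whenever \<open>u \<le> (\<mu> - c)\<^sup>2\<close>. The constant in the hypothesis on \<open>T\<close>
  corresponds to the chord bound \<open>1 - exp (- 2u) \<ge> (1 - exp (- 2)) u\<close> on \<open>[0, 1]\<close>. Here
  \<open>u \<le> 1/16\<close>, and there \<open>1 - exp (- 2u)\<close> is more than twice as large. This slack pays for \<open>p D = 1/2\<close>
  in the case \<open>D = 1\<close>, and what remains for large \<open>n\<close> absorbs the sum of the two error types.
\<close>

section \<open>Drawing the matrix row by row\<close>

text \<open>Makes the tests independent: the matrix law becomes a product over rows, so expectations
  of products over tests factor. As \<open>case_prod\<close> is injective, it suffices to compare
  point masses.\<close>

lemma Pi_pmf_curry: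
  assumes "finite A" "finite B"
  shows "Pi_pmf (A \<times> B) d (\<lambda>(i, j). p i j)
    = map_pmf case_prod (Pi_pmf A (\<lambda>_. d) (\<lambda>i. Pi_pmf B d (p i)))"
proof (rule pmf_eqI)
  fix M :: "'a \<times> 'b \<Rightarrow> 'c"
  have "inj (case_prod :: ('a \<Rightarrow> 'b \<Rightarrow> 'c) \<Rightarrow> _)"
    by (rule injI) (metis curry_case_prod)
  then have "pmf (map_pmf case_prod (Pi_pmf A (\<lambda>_. d) (\<lambda>i. Pi_pmf B d (p i)))) (case_prod (curry M))
      = pmf (Pi_pmf A (\<lambda>_. d) (\<lambda>i. Pi_pmf B d (p i))) (curry M)"
    by (rule pmf_map_inj')
  also have "\<dots> = (if \<forall>i. i \<notin> A \<longrightarrow> curry M i = (\<lambda>_. d)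
      then \<Prod>i\<in>A. pmf (Pi_pmf B d (p i)) (curry M i) else 0)"
    by (subst pmf_Pi) (use assms in auto)
  also have "\<dots> = pmf (Pi_pmf (A \<times> B) d (\<lambda>(i, j). p i j)) M"
  proof (cases "\<forall>x. x \<notin> A \<times> B \<longrightarrow> M x = d")
    case True
    then show ?thesis
      using assms
      by (subst (2) pmf_Pi)
         (auto simp: pmf_Pi prod.cartesian_product split_def fun_eq_iff cong: prod.cong intro!: prod.cong)
  next
    case False
    then obtain i j where ij: "(i, j) \<notin> A \<times> B" "M (i, j) \<noteq> d" by auto
    \<comment> \<open>The bad entry lies either in a row outside \<open>A\<close>, which is then not
      constantly \<open>d\<close>, or in a row of \<open>A\<close> at a column outside
      \<open>B\<close>, and then that row has mass 0.\<close>
    then have "\<not> (\<forall>i. i \<notin> A \<longrightarrow> curry M i = (\<lambda>_. d)) \<or> (\<Prod>i\<in>A. pmf (Pi_pmf B d (p i)) (curry M i)) = 0"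
    proof (cases "i \<in> A")
      case True
      then have "pmf (Pi_pmf B d (p i)) (curry M i) = 0"
        using ij assms by (intro pmf_Pi_outside) auto
      then show ?thesis using True assms by auto
    next
      case False
      then show ?thesis using ij by (auto simp: fun_eq_iff)
    qed
    moreover have "pmf (Pi_pmf (A \<times> B) d (\<lambda>(i, j). p i j)) M = 0"
      using False assms by (intro pmf_Pi_outside) auto
    ultimately show ?thesis by auto
  qed
  finally show "pmf (Pi_pmf (A \<times> B) d (\<lambda>(i, j). p i j)) M
    = pmf (map_pmf case_prod (Pi_pmf A (\<lambda>_. d) (\<lambda>i. Pi_pmf B d (p i)))) M"
    by (simp add: case_prod_curry)
qed

section \<open>Hoeffding's lemma for Bernoulli variables\<close>

text \<open>Hoeffding's lemma treats the variable centred at its mean \<open>p\<close>, with range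
  of length 1; the factor \<open>exp (l * (p - c))\<close> moves the centre to
  \<open>c\<close>.\<close>

lemma bernoulli_mgf_le_pos:
  fixes p c l :: real
  assumes "0 \<le> p" "p \<le> 1" "l > 0"
  shows "p * exp (l * (1 - c)) + (1 - p) * exp (- (l * c)) \<le> exp (l * (p - c) + l\<^sup>2 / 8)"
proof -
  define f :: "bool \<Rightarrow> real" where "f b = of_bool b" for b
  interpret interval_bounded_random_variable "measure_pmf (bernoulli_pmf p)" f 0 1
    by unfold_locales (auto simp: f_def)
  have E: "measure_pmf.expectation (bernoulli_pmf p) f = p"
    unfolding f_def by (subst integral_bernoulli_pmf) (use assms in auto)
  have "ennreal (measure_pmf.expectation (bernoulli_pmf p) (\<lambda>b. exp (l * (f b - p)))) \<le> ennreal (exp (l\<^sup>2 / 8))"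
    using Hoeffdings_lemma_nn_integral[of l] assms E
    by (subst nn_integral_eq_integral [symmetric])
       (auto simp: integrable_measure_pmf_finite)
  then have "p * exp (l * (1 - p)) + (1 - p) * exp (- (l * p)) \<le> exp (l\<^sup>2 / 8)"
    using assms by (simp add: f_def mult.commute flip: ennreal_plus)
  then have "exp (l * (p - c)) * (p * exp (l * (1 - p)) + (1 - p) * exp (- (l * p)))
      \<le> exp (l * (p - c)) * exp (l\<^sup>2 / 8)"
    by (intro mult_left_mono) auto
  then show ?thesis
    by (simp add: algebra_simps flip: exp_add)
qed

lemma bernoulli_mgf_le:
  fixes p c l :: real
  assumes "0 \<le> p" "p \<le> 1"
  shows "p * exp (l * (1 - c)) + (1 - p) * exp (- (l * c)) \<le> exp (l * (p - c) + l\<^sup>2 / 8)"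
proof -
  consider "l > 0" | "l = 0" | "l < 0" by linarith
  then show ?thesis
  proof cases
    case 1
    then show ?thesis using bernoulli_mgf_le_pos assms by blast
  next
    \<comment> \<open>Exchanging success and failure replaces \<open>p\<close>, \<open>c\<close>,
      \<open>l\<close> by \<open>1 - p\<close>, \<open>1 - c\<close>, \<open>- l\<close> and reduces
      to the positive case.\<close>
    case 3
    then show ?thesis
      using bernoulli_mgf_le_pos[of "1 - p" "- l" "1 - c"] assms by (simp add: algebra_simps)
  qed simp
qed

section \<open>One row of the matrix\<close>

text \<open>The factor \<open>w\<close> is the chance that a test on \<open>j\<close> has no
  defective item: 0 if \<open>j\<close> is defective itself, and otherwise independent of the entry
  at \<open>j\<close>.\<close>

lemma row_expectation:
  fixes h :: "bool \<Rightarrow> real" and p :: real and x :: "nat \<Rightarrow> bool"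
  assumes "0 \<le> p" "p \<le> 1" "j < n"
  defines "w \<equiv> (if x j then 0 else (1 - p) ^ card {k. k < n \<and> x k})"
  shows "measure_pmf.expectation (Pi_pmf {..<n} False (\<lambda>_. bernoulli_pmf p))
           (\<lambda>r. if r j then h (\<exists>k<n. r k \<and> x k) else 1)
         = 1 - p + p * ((1 - w) * h True + w * h False)"
proof -
  let ?P = "Pi_pmf {..<n} False (\<lambda>_. bernoulli_pmf p)"
  define E1 where "E1 = {r :: nat \<Rightarrow> bool. r j}"
  define E2 where "E2 = {r :: nat \<Rightarrow> bool. r j \<and> (\<forall>k<n. x k \<longrightarrow> \<not> r k)}"
  have "E1 = Pi {..<n} (\<lambda>k. if k = j then {True} else UNIV)"
    using assms(3) by (auto simp: E1_def Pi_def)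
  then have P1: "measure_pmf.prob ?P E1 = p"
    using assms by (simp add: measure_Pi_pmf_Pi if_distrib[of "measure_pmf.prob _"]
        measure_pmf_single cong: if_cong)
  have P2: "measure_pmf.prob ?P E2 = p * w"
  proof (cases "x j")
    case True
    then have "E2 = {}" using assms(3) by (auto simp: E2_def)
    then show ?thesis using True by (simp add: w_def)
  next
    case False
    \<comment> \<open>The event is a box; as \<open>x j\<close> fails, the constraints at
      \<open>j\<close> and at the defective items concern different coordinates.\<close>
    have "E2 = Pi {..<n} (\<lambda>k. if k = j then {True} else if x k then {False} else UNIV)"
      using assms(3) False by (auto simp: E2_def Pi_def)
    then have "measure_pmf.prob ?P E2
        = (\<Prod>k<n. (if k = j then p else 1) * (if x k then 1 - p else 1))"
      using assms(1,2) False by (auto simp: measure_Pi_pmf_Pi measure_pmf_single intro!: prod.cong)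
    also have "\<dots> = p * w"
      using assms(3) False
      by (simp add: prod.distrib w_def prod.If_cases lessThan_def flip: Collect_conj_eq)
    finally show ?thesis .
  qed
  have [simp]: "finite (set_pmf ?P)"
    by (simp add: set_Pi_pmf finite_PiE_dflt)
  \<comment> \<open>The integrand is 1 off \<open>E1\<close>, \<open>h True\<close> on
    \<open>E1 - E2\<close> and \<open>h False\<close> on \<open>E2\<close>, so the two probabilities
    determine its expectation.\<close>
  have "(\<lambda>r. if r j then h (\<exists>k<n. r k \<and> x k) else 1)
      = (\<lambda>r. 1 + (h True - 1) * indicat_real E1 r + (h False - h True) * indicat_real E2 r)"
  proof (rule ext)
    fix r :: "nat \<Rightarrow> bool"
    show "(if r j then h (\<exists>k<n. r k \<and> x k) else 1)
      = 1 + (h True - 1) * indicat_real E1 r + (h False - h True) * indicat_real E2 r"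
    proof -
      define e where "e \<longleftrightarrow> (\<exists>k<n. r k \<and> x k)"
      have "r \<in> E1 \<longleftrightarrow> r j" "r \<in> E2 \<longleftrightarrow> r j \<and> \<not> e" by (auto simp: E1_def E2_def e_def)
      then show ?thesis unfolding e_def [symmetric] by (cases e; cases "r j") simp_all
    qed
  qed
  then show ?thesis
    by (simp add: P1 P2 integrable_measure_pmf_finite algebra_simps)
qed

section \<open>Elementary inequalities\<close>

text \<open>The chord of the concave left side over \<open>[0, 1 / 16]\<close> has slope about 1.88,
  so \<open>15 / 8\<close> is nearly the best constant. After multiplication by
  \<open>exp (2 * u)\<close>, the quadratic Taylor bound suffices.\<close>

lemma one_minus_exp_ge:
  fixes u :: real
  assumes "0 \<le> u" "u \<le> 1 / 16"
  shows "1 - exp (- 2 * u) \<ge> 15 / 8 * u"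
proof -
  have "(1 - 15 / 8 * u) * (1 + 2 * u + (2 * u)\<^sup>2 / 2) \<ge> 1"
  proof -
    have "(1 - 15 / 8 * u) * (1 + 2 * u + (2 * u)\<^sup>2 / 2) - 1 = u * (1 / 8 - 7 / 4 * u - 15 / 4 * u\<^sup>2)"
      by (simp add: algebra_simps power2_eq_square)
    \<comment> \<open>The bracket is only about 0.001 at \<open>u = 1 / 16\<close>. Replacing its
      square by \<open>u / 16\<close> makes it linear and loses nothing at that endpoint.\<close>
    moreover have "u\<^sup>2 \<le> (1 / 16) * u"
      using assms unfolding power2_eq_square by (intro mult_right_mono)
    moreover have "0 \<le> u * (1 / 8 - 7 / 4 * u - 15 / 4 * u\<^sup>2)"
      using assms calculation(2) by (intro mult_nonneg_nonneg) linarith+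
    ultimately show ?thesis by linarith
  qed
  also have "\<dots> \<le> (1 - 15 / 8 * u) * exp (2 * u)"
    using assms by (intro mult_left_mono exp_lower_Taylor_quadratic) auto
  finally show ?thesis
    by (simp add: exp_minus field_simps)
qed

text \<open>The expression is the convex combination \<open>(1 - w) * (1 - q) + w * q\<close>, the
  chance that a test on the item is observed positive.\<close>

lemma flip_prob_bounds:
  fixes q w :: real
  assumes "0 \<le> q" "q \<le> 1" "0 \<le> w" "w \<le> 1"
  shows "0 \<le> 1 - q - (1 - 2 * q) * w" "1 - q - (1 - 2 * q) * w \<le> 1"
proof -
  have "(1 - 2 * q) * w = (1 - q) * w - q * w" by (simp add: algebra_simps)
  moreover have "0 \<le> (1 - q) * w" "0 \<le> q * w" "(1 - q) * w \<le> 1 - q" "q * w \<le> q"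
    using assms by (simp_all add: mult_left_le)
  ultimately show "0 \<le> 1 - q - (1 - 2 * q) * w" "1 - q - (1 - 2 * q) * w \<le> 1"
    by linarith+
qed

section \<open>Chernoff bound for one item\<close>

text \<open>The sign of \<open>l\<close> is left free so that one bound serves both error types. The
  noise bits are integrated out first and then the independent rows, which gives the
  \<open>T\<close>-th power.\<close>

lemma column_error_le:
  fixes q c l :: real and x :: "nat \<Rightarrow> bool" and D :: nat
  assumes "0 \<le> q" "q \<le> 1" "j < n"
  defines "p \<equiv> nocoma_p D"
  defines "w \<equiv> (if x j then 0 else (1 - p) ^ card {k. k < n \<and> x k})"
  defines "\<mu> \<equiv> 1 - q - (1 - 2 * q) * w"
  shows "measure_pmf.prob (nocoma_pmf n T D q)
      {(M, z). 0 \<le> l * (real (card (positive_tests_of T M (observed_outcome n M z x) j))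
                          - real (card (tests_of T M j)) * c)}
    \<le> (1 - p + p * (\<mu> * exp (l * (1 - c)) + (1 - \<mu>) * exp (- (l * c)))) ^ T"
proof -
  have p: "0 \<le> p" "p \<le> 1" by (auto simp: p_def nocoma_p_def)
  have w: "0 \<le> w" "w \<le> 1" using p by (auto simp: w_def power_le_one)
  have \<mu>: "0 \<le> \<mu>" "\<mu> \<le> 1"
    unfolding \<mu>_def using flip_prob_bounds[OF assms(1,2) w] .
  \<comment> \<open>\<open>F r b\<close> is the factor of a test with row \<open>r\<close> and noise
    bit \<open>b\<close>; \<open>h\<close> averages it over the noise, given the noiseless outcome
    of a test on \<open>j\<close>.\<close>
  define h where "h b = (1 - q) * exp (l * (of_bool b - c)) + q * exp (l * (of_bool (\<not> b) - c))" for b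
  define F where "F r b = (if r j then exp (l * (of_bool ((\<exists>k<n. r k \<and> x k) \<noteq> b) - c)) else 1)"
    for r :: "nat \<Rightarrow> bool" and b
  define S :: "gt_matrix \<Rightarrow> (nat \<Rightarrow> bool) \<Rightarrow> real" where
    "S M z = real (card (positive_tests_of T M (observed_outcome n M z x) j))
       - real (card (tests_of T M j)) * c" for M z
  let ?row = "Pi_pmf {..<n} False (\<lambda>_. bernoulli_pmf p)"
  let ?noise = "Pi_pmf {..<T} False (\<lambda>_. bernoulli_pmf q)"
  have fin: "finite (set_pmf ?row)"
    by (simp add: set_Pi_pmf finite_PiE_dflt)
  have S: "exp (l * S M z) = (\<Prod>i<T. F (curry M i) (z i))" for M z
  proof -
    have "S M z = (\<Sum>i<T. of_bool (M (i, j)) * (of_bool (observed_outcome n M z x i) - c))"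
      by (simp add: S_def tests_of_def positive_tests_of_def right_diff_distrib sum_subtractf
          flip: sum_distrib_right of_bool_conj)
         (simp add: of_bool_def sum.If_cases lessThan_def flip: Collect_conj_eq)
    then have "exp (l * S M z)
        = (\<Prod>i<T. exp (l * (of_bool (M (i, j)) * (of_bool (observed_outcome n M z x i) - c))))"
      by (simp only: sum_distrib_left exp_sum finite_lessThan)
    also have "\<dots> = (\<Prod>i<T. F (curry M i) (z i))"
      by (intro prod.cong) (auto simp: F_def observed_outcome_def noiseless_outcome_def)
    finally show ?thesis .
  qed
  have F: "(\<integral>\<^sup>+b. F r b \<partial>bernoulli_pmf q)
      = ennreal (if r j then h (\<exists>k<n. r k \<and> x k) else 1)" for r
    using assms(1,2)
    by (subst nn_integral_eq_integral)
       (auto simp: F_def h_def mult_ac integrable_measure_pmf_finite simp flip: ennreal_plus)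
  have h: "0 \<le> h b" for b using assms(1,2) by (simp add: h_def)
  have "ennreal (measure_pmf.prob (nocoma_pmf n T D q) {(M, z). 0 \<le> l * S M z})
      = (\<integral>\<^sup>+y. indicator {(M, z). 0 \<le> l * S M z} y \<partial>nocoma_pmf n T D q)"
    by (simp add: measure_pmf.emeasure_eq_measure)
  \<comment> \<open>Markov's inequality: the exponential is at least 1 on the event.\<close>
  also have "\<dots> \<le> (\<integral>\<^sup>+(M, z). ennreal (exp (l * S M z)) \<partial>nocoma_pmf n T D q)"
    by (intro nn_integral_mono) (auto simp: indicator_def split: prod.split)
  also have "\<dots> = (\<integral>\<^sup>+M. \<integral>\<^sup>+z. (\<Prod>i<T. ennreal (F (curry M i) (z i))) \<partial>?noise
      \<partial>Pi_pmf ({..<T} \<times> {..<n}) False (\<lambda>(i, j). bernoulli_pmf p))"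
  proof -
    have "F r b \<ge> 0" for r b by (simp add: F_def)
    then show ?thesis
      by (simp add: nocoma_pmf_def p_def nn_integral_pair_pmf' S prod_ennreal split_def)
  qed
  also have "\<dots> = (\<integral>\<^sup>+M. (\<Prod>i<T. \<integral>\<^sup>+b. F (M i) b \<partial>bernoulli_pmf q)
      \<partial>Pi_pmf {..<T} (\<lambda>_. False) (\<lambda>_. ?row))"
  proof -
    have "(\<integral>\<^sup>+z. (\<Prod>i<T. ennreal (F (M i) (z i))) \<partial>?noise)
        = (\<Prod>i<T. \<integral>\<^sup>+b. F (M i) b \<partial>bernoulli_pmf q)" for M :: "nat \<Rightarrow> nat \<Rightarrow> bool"
      by (rule nn_integral_prod_Pi_pmf) simp
    then show ?thesis by (subst Pi_pmf_curry) simp_all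
  qed
  also have "\<dots> = (\<integral>\<^sup>+r. ennreal (if r j then h (\<exists>k<n. r k \<and> x k) else 1) \<partial>?row) ^ T"
    unfolding F by (subst nn_integral_prod_Pi_pmf) simp_all
  also have "\<dots> = ennreal ((1 - p + p * ((1 - w) * h True + w * h False)) ^ T)"
  proof -
    have "0 \<le> 1 - p + p * ((1 - w) * h True + w * h False)"
      using p w h by (intro add_nonneg_nonneg mult_nonneg_nonneg) auto
    then show ?thesis
      using row_expectation[OF p assms(3), where x = x and h = h] h fin
      by (subst nn_integral_eq_integral)
         (auto simp: integrable_measure_pmf_finite ennreal_power simp flip: w_def)
  qed
  \<comment> \<open>Collecting the two exponentials: the observed outcome of a test on
    \<open>j\<close> is Bernoulli with mean \<open>\<mu>\<close>.\<close>
  also have "(1 - w) * h True + w * h False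
      = \<mu> * exp (l * (1 - c)) + (1 - \<mu>) * exp (- (l * c))"
    by (simp add: h_def \<mu>_def algebra_simps)
  finally show ?thesis
    using p \<mu> unfolding S_def by (simp add: ennreal_le_iff)
qed

text \<open>The choice \<open>l = 4 * (c - \<mu>)\<close> minimises the exponent
  \<open>l * (\<mu> - c) + l\<^sup>2 / 8\<close>, with minimum
  \<open>- 2 * (\<mu> - c)\<^sup>2\<close>. The sign of \<open>c - \<mu>\<close> selects the tail
  away from the mean.\<close>

lemma column_error_exp_le:
  fixes q c u :: real and x :: "nat \<Rightarrow> bool" and D :: nat
  assumes "0 \<le> q" "q \<le> 1" "j < n"
  defines "p \<equiv> nocoma_p D"
  defines "w \<equiv> (if x j then 0 else (1 - p) ^ card {k. k < n \<and> x k})"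
  defines "\<mu> \<equiv> 1 - q - (1 - 2 * q) * w"
  assumes "u \<le> (\<mu> - c)\<^sup>2"
  shows "measure_pmf.prob (nocoma_pmf n T D q)
      {(M, z). 0 \<le> (c - \<mu>) * (real (card (positive_tests_of T M (observed_outcome n M z x) j))
                          - real (card (tests_of T M j)) * c)}
    \<le> exp (- (p * real T * (1 - exp (- 2 * u))))"
proof -
  have p: "0 \<le> p" "p \<le> 1" by (auto simp: p_def nocoma_p_def)
  have w: "0 \<le> w" "w \<le> 1" using p by (auto simp: w_def power_le_one)
  have \<mu>: "0 \<le> \<mu>" "\<mu> \<le> 1"
    unfolding \<mu>_def using flip_prob_bounds[OF assms(1,2) w] .
  let ?A = "\<mu> * exp (4 * (c - \<mu>) * (1 - c)) + (1 - \<mu>) * exp (- (4 * (c - \<mu>) * c))"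
  have "?A \<le> exp (4 * (c - \<mu>) * (\<mu> - c) + (4 * (c - \<mu>))\<^sup>2 / 8)"
    by (rule bernoulli_mgf_le) (use \<mu> in auto)
  also have "4 * (c - \<mu>) * (\<mu> - c) + (4 * (c - \<mu>))\<^sup>2 / 8 = - 2 * (\<mu> - c)\<^sup>2"
    by (simp add: power2_eq_square field_simps)
  also have "exp (- 2 * (\<mu> - c)\<^sup>2) \<le> exp (- 2 * u)" using assms(7) by simp
  finally have A: "?A \<le> exp (- 2 * u)" .
  have "{(M, z). 0 \<le> (c - \<mu>) * (real (card (positive_tests_of T M (observed_outcome n M z x) j))
                          - real (card (tests_of T M j)) * c)}
      = {(M, z). 0 \<le> 4 * (c - \<mu>) * (real (card (positive_tests_of T M (observed_outcome n M z x) j))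
                          - real (card (tests_of T M j)) * c)}"
  proof -
    have "0 \<le> 4 * t \<longleftrightarrow> 0 \<le> t" for t :: real by simp
    then show ?thesis by (simp only: mult.assoc)
  qed
  then have "measure_pmf.prob (nocoma_pmf n T D q)
      {(M, z). 0 \<le> (c - \<mu>) * (real (card (positive_tests_of T M (observed_outcome n M z x) j))
                          - real (card (tests_of T M j)) * c)}
    \<le> (1 - p + p * ?A) ^ T"
    using column_error_le[OF assms(1-3), of T D "4 * (c - \<mu>)" x c]
    unfolding \<mu>_def w_def p_def by simp
  \<comment> \<open>Uses \<open>1 - t \<le> exp (- t)\<close> with
    \<open>t = p * (1 - exp (- 2 * u))\<close>.\<close>
  also have "\<dots> \<le> exp (- (p * (1 - exp (- 2 * u)))) ^ T"
  proof (rule power_mono)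
    have "p * ?A \<le> p * exp (- 2 * u)" by (rule mult_left_mono[OF A p(1)])
    then show "1 - p + p * ?A \<le> exp (- (p * (1 - exp (- 2 * u))))"
      using exp_ge_add_one_self[of "- (p * (1 - exp (- 2 * u)))"] by (simp add: algebra_simps)
    show "0 \<le> 1 - p + p * ?A" using p \<mu> by simp
  qed
  also have "\<dots> = exp (- (p * real T * (1 - exp (- 2 * u))))"
    by (simp add: mult_ac flip: exp_of_nat_mult)
  finally show ?thesis .
qed

section \<open>The exponent for the given number of tests\<close>

text \<open>Normalising \<open>u\<close> through \<open>v\<close> cancels the constant in the bound
  on \<open>T\<close>. It is applied with \<open>v = \<gamma>\<close> for missed defectives and
  \<open>v = 1\<close> for false positives. The factor halves at \<open>D = 1\<close>, where
  \<open>nocoma_p D * real D\<close> is \<open>1 / 2\<close>.\<close>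

lemma exponent_ge:
  fixes q \<gamma> \<delta> u v :: real
  assumes "q < 1 / 2" "0 < \<gamma>" "0 < \<delta>" "1 \<le> n" "1 \<le> D" "0 \<le> u" "u \<le> 1 / 16"
    and T: "real T \<ge> 16 * (1 + sqrt \<gamma>)\<^sup>2 * (1 + \<delta>) * ln 2 / ((1 - exp (- 2)) * (1 - 2 * q)\<^sup>2)
               * real D * log 2 (real n)"
    and u: "16 * (1 + sqrt \<gamma>)\<^sup>2 * u = v * (1 - 2 * q)\<^sup>2"
  shows "nocoma_p D * real T * (1 - exp (- 2 * u))
    \<ge> (if D = 1 then 21 / 20 else 21 / 10) * (v * (1 + \<delta>) * ln (real n))"
proof -
  let ?X = "16 * (1 + sqrt \<gamma>)\<^sup>2 * (1 + \<delta>) * ln 2 / ((1 - exp (- 2)) * (1 - 2 * q)\<^sup>2)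
               * real D * log 2 (real n)"
  define g where "g = 1 - exp (- 2 :: real)"
  \<comment> \<open>The slack: \<open>(15/8) / (1 - exp (- 2)) \<ge> 21/10\<close>.\<close>
  have "exp 2 \<le> (9 :: real)"
    using exp_le power_mono[of "exp 1" "3::real" 2] by (simp flip: exp_of_nat_mult)
  then have g: "0 < g" "g \<le> 8 / 9" by (simp_all add: g_def exp_minus field_simps)
  have v: "0 \<le> v"
  proof -
    have "0 \<le> v * (1 - 2 * q)\<^sup>2"
      unfolding u [symmetric] using assms(6) by simp
    then show ?thesis using assms by (simp add: zero_le_mult_iff)
  qed
  define L where "L = v * (1 + \<delta>) * ln (real n)"
  have L: "0 \<le> L" using v assms by (simp add: L_def)
  have pD: "nocoma_p D * real D = (if D = 1 then 1 / 2 else 1)"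
    using assms by (auto simp: nocoma_p_def)
  have "(if D = 1 then 21 / 20 else 21 / 10) * L \<le> (nocoma_p D * real D) * (15 / 8 / g * L)"
  proof -
    have "21 / 10 \<le> 15 / 8 / g" using g by (simp add: field_simps)
    then have "21 / 10 * L \<le> 15 / 8 / g * L" using L by (rule mult_right_mono)
    then show ?thesis unfolding pD by simp
  qed
  also have "\<dots> = nocoma_p D * ?X * (15 / 8 * u)"
  proof -
    \<comment> \<open>The factor \<open>ln 2\<close> cancels against the denominator of
      \<open>log 2 (real n)\<close>.\<close>
    have "?X * (15 / 8 * u)
       = (16 * (1 + sqrt \<gamma>)\<^sup>2 * u) / (1 - 2 * q)\<^sup>2 * (1 + \<delta>) * ln (real n) / g * (15 / 8) * real D"
      by (simp add: log_def g_def)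
    also have "\<dots> = v * (1 + \<delta>) * ln (real n) / g * (15 / 8) * real D"
      unfolding u using assms(1) by simp
    finally have "nocoma_p D * ?X * (15 / 8 * u)
        = nocoma_p D * (v * (1 + \<delta>) * ln (real n) / g * (15 / 8) * real D)"
      by (simp only: mult.assoc)
    then show ?thesis by (simp add: L_def mult_ac)
  qed
  also have "\<dots> \<le> nocoma_p D * real T * (1 - exp (- 2 * u))"
    using T one_minus_exp_ge[OF assms(6,7)] assms(6)
    by (intro mult_mono mult_left_mono) (auto simp: nocoma_p_def)
  finally show ?thesis unfolding L_def .
qed

section \<open>Separation of the means and the union bound\<close>

text \<open>Keeps the mean outcome for a nondefective item at least \<open>(1 - 2 * q) / 4\<close>
  below \<open>1 - q\<close>. The worst case is \<open>d = D\<close>; there \<open>1 / 4\<close> is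
  attained at \<open>D = 2\<close>, and the values increase afterwards.\<close>

lemma quarter_le_no_defective:
  assumes "1 \<le> D" "d \<le> D"
  shows "(1 - nocoma_p D) ^ d \<ge> 1 / 4"
proof -
  have "(1 - nocoma_p D) ^ D \<ge> 1 / 4"
  proof (cases "D \<ge> 2")
    case True
    have "(1 / 4 :: real) \<le> (1 - 1 / real D) ^ D"
      using True
    proof (induction D rule: dec_induct)
      case base
      show ?case by (simp add: power2_eq_square)
    next
      case (step m)
      \<comment> \<open>The sequence \<open>(1 - 1/m)\<^sup>m\<close> is increasing.\<close>
      define a where "a = real m"
      have a: "a \<ge> 2" using step by (simp add: a_def)
      then have b: "a\<^sup>2 - 1 > 0" by (simp add: power2_eq_square less_1_mult)
      \<comment> \<open>The next term is the current one times
        \<open>(1 + 1 / (a\<^sup>2 - 1)) ^ m * (a / (a + 1))\<close>. Bernoulli's inequality bounds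
        this ratio from below by the factor here, which is at least 1.\<close>
      have "(1 - 1 / a) ^ m \<le> (1 - 1 / a) ^ m * ((1 + a * (1 / (a\<^sup>2 - 1))) * (a / (a + 1)))"
      proof -
        have "(a\<^sup>2 - 1) * (a + 1) \<le> (a\<^sup>2 - 1 + a) * a"
          by (simp add: algebra_simps power2_eq_square)
        moreover have "(1 + a * (1 / (a\<^sup>2 - 1))) * (a / (a + 1))
            = ((a\<^sup>2 - 1 + a) * a) / ((a\<^sup>2 - 1) * (a + 1))"
        proof -
          have "(1 + a * (1 / b)) * (a / (a + 1)) = ((b + a) * a) / (b * (a + 1))" if "b > 0" for b
            using a that by (simp add: field_simps)
          then show ?thesis using b .
        qed
        ultimately have "1 \<le> (1 + a * (1 / (a\<^sup>2 - 1))) * (a / (a + 1))"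
          using a b by simp
        moreover have "0 \<le> (1 - 1 / a) ^ m" using a by simp
        ultimately have "(1 - 1 / a) ^ m * 1
            \<le> (1 - 1 / a) ^ m * ((1 + a * (1 / (a\<^sup>2 - 1))) * (a / (a + 1)))"
          by (rule mult_left_mono)
        then show ?thesis by (simp only: mult_1_right)
      qed
      also have "\<dots> \<le> (1 - 1 / a) ^ m * ((1 + 1 / (a\<^sup>2 - 1)) ^ m * (a / (a + 1)))"
      proof -
        have "0 \<le> 1 / (a\<^sup>2 - 1)" using b by simp
        then have "1 + a * (1 / (a\<^sup>2 - 1)) \<le> (1 + 1 / (a\<^sup>2 - 1)) ^ m"
          unfolding a_def by (intro Bernoulli_inequality) linarith
        then show ?thesis using a by (intro mult_left_mono mult_right_mono) auto
      qed
      also have "\<dots> = ((1 - 1 / a) * (1 + 1 / (a\<^sup>2 - 1))) ^ m * (a / (a + 1))"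
        by (simp add: power_mult_distrib)
      also have "(1 - 1 / a) * (1 + 1 / (a\<^sup>2 - 1)) = a / (a + 1)"
      proof -
        have "1 - 1 / a = (a - 1) / a" using a by (simp add: field_simps)
        moreover have "1 + 1 / (a\<^sup>2 - 1) = a\<^sup>2 / (a\<^sup>2 - 1)" using b by (simp add: field_simps)
        moreover have "a\<^sup>2 - 1 = (a - 1) * (a + 1)" by (simp add: power2_eq_square algebra_simps)
        ultimately show ?thesis using a by (simp add: power2_eq_square)
      qed
      also have "(a / (a + 1)) ^ m * (a / (a + 1)) = (1 - 1 / real (Suc m)) ^ Suc m"
        using a by (simp add: a_def field_simps)
      finally show ?case using step unfolding a_def by linarith
    qed
    then show ?thesis using True by (simp add: nocoma_p_def)
  next
    case False
    then have "D = 1" using assms by simp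
    then show ?thesis by (simp add: nocoma_p_def)
  qed
  also have "(1 - nocoma_p D) ^ D \<le> (1 - nocoma_p D) ^ d"
    using assms by (intro power_decreasing) (auto simp: nocoma_p_def)
  finally show ?thesis .
qed

text \<open>
  The parameter \<open>s\<close> is \<open>sqrt \<gamma>\<close>; the two exponents are those of missed defectives and of false
  positives.
\<close>

lemma nocoma_error_prob_le:
  fixes q s \<tau> :: real and x :: "nat \<Rightarrow> bool"
  assumes q: "0 < q" "q < 1 / 2" and D: "1 \<le> D" "card {j. j < n \<and> x j} \<le> D"
    and s: "0 < s" and \<tau>: "q * \<tau> = (1 - 2 * q) * s / (4 * (1 + s))"
  shows "nocoma_error_prob n T D q \<tau> x
    \<le> real D * exp (- (nocoma_p D * real T * (1 - exp (- 2 * (q * \<tau>)\<^sup>2))))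
      + real n * exp (- (nocoma_p D * real T * (1 - exp (- 2 * ((1 - 2 * q) / (4 * (1 + s)))\<^sup>2))))"
    (is "_ \<le> real D * ?a + real n * ?b")
proof -
  let ?P = "measure_pmf.prob (nocoma_pmf n T D q)"
  define c where "c = 1 - q * (1 + \<tau>)"
  define E where
    "E j = {(M, z). nocoma_decode T q \<tau> M (observed_outcome n M z x) j \<noteq> x j}" for j
  have q\<tau>: "0 \<le> q * \<tau>" unfolding \<tau> using q s by simp
  have E: "?P (E j) \<le> (if x j then ?a else ?b)" if j: "j < n" for j
  proof -
    define w where "w = (if x j then 0 else (1 - nocoma_p D) ^ card {k. k < n \<and> x k})"
    define \<mu> where "\<mu> = 1 - q - (1 - 2 * q) * w"
    define u where "u = (if x j then (q * \<tau>)\<^sup>2 else ((1 - 2 * q) / (4 * (1 + s)))\<^sup>2)"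
    define S where "S M z = real (card (positive_tests_of T M (observed_outcome n M z x) j))
                          - real (card (tests_of T M j)) * c" for M z
    have sgn: "(if x j then c - \<mu> \<le> 0 else 0 \<le> c - \<mu>) \<and> u \<le> (\<mu> - c)\<^sup>2"
    proof (cases "x j")
      case True
      then show ?thesis using q\<tau> by (simp add: \<mu>_def w_def c_def u_def algebra_simps)
    next
      case False
      have "(1 - 2 * q) * (1 / 4) \<le> (1 - 2 * q) * w"
        using quarter_le_no_defective[OF D] q False by (intro mult_left_mono) (auto simp: w_def)
      \<comment> \<open>\<open>\<tau>\<close> divides the gap \<open>(1 - 2 * q) / 4\<close> in the
        ratio \<open>s\<close> to 1, between the margin of the defective items and that of the
        others.\<close>
      moreover have "(1 - 2 * q) / 4 - q * \<tau> = (1 - 2 * q) / (4 * (1 + s))"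
        unfolding \<tau> using s by (simp add: field_simps)
      moreover have "c - \<mu> = (1 - 2 * q) * w - q * \<tau>"
        by (simp add: c_def \<mu>_def algebra_simps)
      ultimately have le: "(1 - 2 * q) / (4 * (1 + s)) \<le> c - \<mu>"
        by linarith
      moreover have ge: "0 \<le> (1 - 2 * q) / (4 * (1 + s))" using q s by simp
      ultimately show ?thesis
        using False power_mono[OF le ge, of 2] by (simp add: u_def power2_commute)
    qed
    \<comment> \<open>A misclassified item has a score of the wrong sign; ties, which decode as
      defective, are covered by the weak inequality.\<close>
    have "E j \<subseteq> {(M, z). 0 \<le> (c - \<mu>) * S M z}"
      using sgn by (cases "x j")
        (auto simp: E_def nocoma_decode_def S_def c_def intro: mult_nonpos_nonpos mult_nonneg_nonneg)
    then have "?P (E j) \<le> ?P {(M, z). 0 \<le> (c - \<mu>) * S M z}"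
      by (intro measure_pmf.finite_measure_mono) auto
    also have "\<dots> \<le> exp (- (nocoma_p D * real T * (1 - exp (- 2 * u))))"
      unfolding S_def \<mu>_def w_def using q sgn j
      by (intro column_error_exp_le) (auto simp: \<mu>_def w_def)
    finally show ?thesis by (simp add: u_def split: if_splits)
  qed
  have "nocoma_error_prob n T D q \<tau> x = ?P (\<Union>j\<in>{..<n}. E j)"
    unfolding nocoma_error_prob_def E_def by (intro arg_cong[where f = ?P]) auto
  also have "\<dots> \<le> (\<Sum>j<n. ?P (E j))"
    by (intro measure_pmf.finite_measure_subadditive_finite) auto
  also have "\<dots> \<le> (\<Sum>j<n. if x j then ?a else ?b)"
    by (intro sum_mono E) simp
  also have "\<dots> = real (card {j. j < n \<and> x j}) * ?a + real (card {j. j < n \<and> \<not> x j}) * ?b"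
    by (simp add: sum.If_cases lessThan_def flip: Collect_conj_eq Collect_neg_eq)
  \<comment> \<open>There are at most \<open>D\<close> defectives, while the other items are counted
    as \<open>n\<close>; so the first exponent only has to beat \<open>ln (real D)\<close>.\<close>
  also have "\<dots> \<le> real D * ?a + real n * ?b"
    using D card_mono[of "{..<n}" "{j. j < n \<and> \<not> x j}"]
    by (intro add_mono mult_right_mono) auto
  finally show ?thesis .
qed

section \<open>Large \<open>n\<close>: combining the two error types\<close>

theorem theorem5:
  fixes \<delta> q :: real and D :: "nat \<Rightarrow> nat"
  assumes "\<delta> > 0"
    and "0 < q" and "q < 1 / 2"
    and "\<And>n. n \<ge> 1 \<Longrightarrow> D n \<ge> 1"
    and "(\<lambda>n. real (D n) / real n) \<longlonglongrightarrow> 0"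
  shows "\<exists>n\<^sub>0. \<forall>n\<ge>n\<^sub>0. \<forall>(d::nat) (x :: nat \<Rightarrow> bool) (T::nat).
    1 \<le> d \<longrightarrow> d \<le> D n \<longrightarrow> card {j. j < n \<and> x j} = d \<longrightarrow>
    real T \<ge> 16 * (1 + sqrt (nocoma_gamma \<delta> n (D n)))\<^sup>2 * (1 + \<delta>) * ln 2
               / ((1 - exp (- 2)) * (1 - 2 * q)\<^sup>2) * real (D n) * log 2 (real n) \<longrightarrow>
    nocoma_error_prob n T (D n) q (nocoma_tau q (nocoma_gamma \<delta> n (D n))) x
      \<le> real n powr (- \<delta>)"
proof -
  note \<delta> = assms(1) and q = assms(2,3) and D1 = assms(4)
  have "eventually (\<lambda>n. real (D n) / real n < 1) sequentially"
    using assms(5) by (rule order_tendstoD) simp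
  then obtain N where N: "\<And>n. n \<ge> N \<Longrightarrow> real (D n) / real n < 1"
    by (auto simp: eventually_sequentially)
  show ?thesis
  \<comment> \<open>The exponential threshold gives
    \<open>ln 2 \<le> \<delta> / 20 * ln (real n)\<close>. This absorbs the factor 2 from adding two
    equal bounds with exponent \<open>21 / 20 * \<delta> * ln (real n)\<close>.\<close>
  proof (intro exI[of _ "max (max N 2) (nat \<lceil>exp (20 * ln 2 / \<delta>)\<rceil>)"] allI impI)
    fix n d T :: nat and x :: "nat \<Rightarrow> bool"
    assume n: "max (max N 2) (nat \<lceil>exp (20 * ln 2 / \<delta>)\<rceil>) \<le> n"
      and d: "1 \<le> d" "d \<le> D n" "card {j. j < n \<and> x j} = d"
      and T: "real T \<ge> 16 * (1 + sqrt (nocoma_gamma \<delta> n (D n)))\<^sup>2 * (1 + \<delta>) * ln 2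
               / ((1 - exp (- 2)) * (1 - 2 * q)\<^sup>2) * real (D n) * log 2 (real n)"
    define L where "L = ln (real n)"
    define \<gamma> where "\<gamma> = nocoma_gamma \<delta> n (D n)"
    define s where "s = sqrt \<gamma>"
    define \<tau> where "\<tau> = nocoma_tau q \<gamma>"
    have n2: "n \<ge> 2" "n \<ge> N" "real n \<ge> exp (20 * ln 2 / \<delta>)" using n by linarith+
    have Dn: "1 \<le> D n" "real (D n) \<le> real n" using D1 n2 N[of n] by auto
    have L: "0 < L" using n2 by (simp add: L_def)
    have "ln (exp (20 * ln 2 / \<delta>)) \<le> L" unfolding L_def using n2 by (subst ln_le_cancel_iff) auto
    then have L20: "ln 2 \<le> \<delta> / 20 * L" using \<delta> by (simp add: field_simps)
    \<comment> \<open>This is what the definition of \<open>\<gamma>\<close> is made for: the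
      exponent for defectives splits into the cost of a union bound over \<open>D n\<close> items
      and the target rate.\<close>
    have \<gamma>L: "\<gamma> * (1 + \<delta>) * L = ln (real (D n)) + \<delta> * L"
      using L \<delta> by (simp add: \<gamma>_def nocoma_gamma_def flip: L_def) (simp add: field_simps)
    have lnD: "0 \<le> ln (real (D n))" using Dn by simp
    have \<gamma>: "0 < \<gamma>"
      using L \<delta> lnD unfolding \<gamma>_def nocoma_gamma_def L_def [symmetric]
      by (intro divide_pos_pos add_nonneg_pos) auto
    have s: "0 < s" "s\<^sup>2 = \<gamma>" using \<gamma> by (simp_all add: s_def)
    have "\<gamma> powr (- 1 / 2) = 1 / s"
      using \<gamma> powr_minus_divide[of \<gamma> "1 / 2"] by (simp add: s_def powr_half_sqrt)
    moreover have inv: "1 + 1 / s = (1 + s) / s" using s by (simp add: field_simps)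
    ultimately have "\<tau> = (1 - 2 * q) / (4 * q * (1 + 1 / s))"
      by (simp only: \<tau>_def nocoma_tau_def)
    then have \<tau>: "q * \<tau> = (1 - 2 * q) * s / (4 * (1 + s))"
      using q s by (simp add: inv)
    define u where "u = (q * \<tau>)\<^sup>2"
    define u' where "u' = ((1 - 2 * q) / (4 * (1 + s)))\<^sup>2"
    define a where "a = nocoma_p (D n) * real T * (1 - exp (- 2 * u))"
    define b where "b = nocoma_p (D n) * real T * (1 - exp (- 2 * u'))"
    have small: "0 \<le> q * \<tau>" "q * \<tau> \<le> 1 / 4" "0 \<le> (1 - 2 * q) / (4 * (1 + s))"
        "(1 - 2 * q) / (4 * (1 + s)) \<le> 1 / 4"
    proof -
      have "(1 - 2 * q) * s \<le> 1 * s" using q s by (intro mult_right_mono) auto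
      then show "q * \<tau> \<le> 1 / 4" unfolding \<tau> using s by (simp add: field_simps)
      show "0 \<le> q * \<tau>" unfolding \<tau> using q s by simp
      show "0 \<le> (1 - 2 * q) / (4 * (1 + s))" using q s by simp
      show "(1 - 2 * q) / (4 * (1 + s)) \<le> 1 / 4" using q s by (simp add: pos_divide_le_eq)
    qed
    have u: "0 \<le> u" "u \<le> 1 / 16" "0 \<le> u'" "u' \<le> 1 / 16"
      using power_mono[OF small(2,1), of 2] power_mono[OF small(4,3), of 2]
      by (simp_all add: u_def u'_def power_divide)
    \<comment> \<open>Used with \<open>y = (1 - 2 * q) * s\<close> and with
      \<open>y = 1 - 2 * q\<close>, to match the normalisations \<open>v = \<gamma>\<close> and
      \<open>v = 1\<close>.\<close>
    have sq: "16 * (1 + s)\<^sup>2 * (y / (4 * (1 + s)))\<^sup>2 = y\<^sup>2" for y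
    proof -
      have "(4 * (1 + s))\<^sup>2 = 16 * (1 + s)\<^sup>2" by (simp only: power_mult_distrib) simp
      then show ?thesis using s(1) by (simp only: power_divide) simp
    qed
    have "16 * (1 + sqrt \<gamma>)\<^sup>2 * u = \<gamma> * (1 - 2 * q)\<^sup>2"
      unfolding u_def \<tau> s_def [symmetric] sq
      by (simp only: power_mult_distrib s(2) mult.commute)
    then have "a \<ge> (if D n = 1 then 21 / 20 else 21 / 10) * (\<gamma> * (1 + \<delta>) * L)"
      unfolding a_def L_def using q \<gamma> \<delta> n2 Dn u T
      by (intro exponent_ge[where \<gamma> = \<gamma>]) (simp_all add: \<gamma>_def)
    then have a: "a \<ge> (if D n = 1 then 21 / 20 else 21 / 10) * (ln (real (D n)) + \<delta> * L)"
      unfolding \<gamma>L .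
    have "16 * (1 + sqrt \<gamma>)\<^sup>2 * u' = 1 * (1 - 2 * q)\<^sup>2"
      unfolding u'_def s_def [symmetric] sq by simp
    then have b: "b \<ge> (if D n = 1 then 21 / 20 else 21 / 10) * (1 * (1 + \<delta>) * L)"
      unfolding b_def L_def using q \<gamma> \<delta> n2 Dn u T
      by (intro exponent_ge[where \<gamma> = \<gamma>]) (simp_all add: \<gamma>_def)
    have \<delta>L: "0 < \<delta> * L" using \<delta> L by simp
    have "nocoma_error_prob n T (D n) q \<tau> x \<le> real (D n) * exp (- a) + real n * exp (- b)"
      unfolding a_def b_def u_def u'_def
      using nocoma_error_prob_le[OF q Dn(1) _ s(1) \<tau>] d by blast
    also have "\<dots> = exp (ln (real (D n)) - a) + exp (L - b)"
      using Dn n2 by (simp add: L_def exp_diff exp_minus field_simps)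
    also have "\<dots> \<le> exp (- (21 / 20 * (\<delta> * L))) + exp (- (21 / 20 * (\<delta> * L)))"
    proof -
      \<comment> \<open>If \<open>D n = 1\<close>, the logarithm vanishes and the factor
        \<open>21 / 20\<close> is just enough; otherwise \<open>21 / 10\<close> leaves room.\<close>
      have "ln (real (D n)) - a \<le> - (21 / 20 * (\<delta> * L))"
        using a lnD \<delta>L by (cases "D n = 1") (simp_all add: algebra_simps)
      moreover have "L - b \<le> - (21 / 20 * (\<delta> * L))"
        using b L \<delta>L by (cases "D n = 1") (simp_all add: algebra_simps)
      ultimately show ?thesis by (intro add_mono) auto
    qed
    also have "\<dots> = exp (ln 2 - 21 / 20 * (\<delta> * L))"
    proof -
      have "exp (- y) + exp (- y) = exp (ln 2 - y)" for y :: real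
        by (simp add: exp_diff exp_minus field_simps)
      then show ?thesis .
    qed
    also have "\<dots> \<le> exp (- \<delta> * L)"
      using L20 by simp
    also have "\<dots> = real n powr (- \<delta>)"
      using n2 by (simp add: powr_def L_def)
    finally show "nocoma_error_prob n T (D n) q (nocoma_tau q (nocoma_gamma \<delta> n (D n))) x
      \<le> real n powr (- \<delta>)"
      by (simp add: \<tau>_def \<gamma>_def)
  qed
qed

end
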